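(* Consider the discounted infinite-horizon POMDP of minimizing $$J(\pi_0;\mu)=\mathbb{E}^\mu\Big[\sum_{k=0}^\infty\gamma^k\big(c(\pi_k)+\lambda\mathbf{1}_{\{s_k=E\}}\big)\,\Big|\,\pi_0^-=\pi_0\Big]$$ over sensor selection policies $\mu:[0,1]\to\{C,E\}$, with two actions corresponding to sensors $E$ and $C$, where $\gamma\in(0,1)$, $\lambda>0$ and $c(\pi)=\min(\pi,1-\pi)$. Suppose that: 1. The instantaneous cost $C(\pi,s)=\lambda\mathbf{1}_{\{s=E\}}+L_s(\pi)$ is concave in $\pi$ for each $s\in\{C,E\}$. 2. Sensor $E$ Blackwell-dominates Sensor $C$: there exists a stochastic matrix $G$ such that $O_C=O_EG$. 3. The transition probabilities of the hidden state $z_k$ are action-independent (the sensor choice does not affect how $z_k$ evolves). Let $\Pi_s=\{\pi\in[0,1]: C(\pi,E)<C(\pi,C)\}$ be the set of beliefs at which the expensive sensor has lower instantaneous cost. Then the optimal policy $\mu^*$, which minimizes $J$, satisfies $\mu^*(\pi)=E$ for all $\pi\in\Pi_s$.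
   Context: **Hidden state.** $\{z_k\}_{k\ge0}$ is a time-homogeneous Markov chain on $\{0,1\}$ with transition probabilities $a_{ij}=\mathbb{P}(z_{k+1}=j\mid z_k=i)$, $a_{i1}=1-a_{i0}$, and $a_{00},a_{11}\in(0,1)$. **Sensors.** At each time $k$ the agent selects a sensor $s_k\in\{C,E\}$ (cheap or expensive) and receives an observation $o_k\in\{0,1\}$ with $\mathbb{P}(o_k=1\mid z_k=0,s_k=s)=\alpha_s$ and $\mathbb{P}(o_k=1\mid z_k=1,s_k=s)=\tau_s$, where $\alpha_s,\tau_s\in[0,1]$. The observation matrix $O_s$ is the $2\times2$ row-stochastic matrix with rows indexed by states and columns by observations, $(O_s)_{ij}=\mathbb{P}(o_k=j\mid z_k=i,s_k=s)$. A stochastic matrix is a nonnegative matrix whose rows sum to $1$. **Beliefs.** $\pi_k^-$ is the predicted belief that $z_k=1$ before the time-$k$ observation, and $\pi_k$ is the posterior belief after it. They satisfy $\pi_k^-=T(\pi_{k-1})=a_{01}(1-\pi_{k-1})+a_{11}\pi_{k-1}$ for $k\ge1$, and $\pi_k=U_s(\pi_k^-,o)$ when $s_k=s$, $o_k=o$, with $$U_s(\pi,1)=\frac{\tau_s\pi}{\tau_s\pi+\alpha_s(1-\pi)},\qquad U_s(\pi,0)=\frac{(1-\tau_s)\pi}{(1-\tau_s)\pi+(1-\alpha_s)(1-\pi)}$$ (values on zero-probability observations are irrelevant). The initial predicted belief is $\pi_0^-=\pi_0$. **Policy.** The policy is applied to the belief available when the sensor is chosen: $s_k=\mu(\pi_k^-)$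 (policies are measurable). An optimal policy minimizes $J(\pi_0;\cdot)$ for every $\pi_0\in[0,1]$. **Expected posterior classification error.** With $p_s^+=\tau_s\pi+\alpha_s(1-\pi)$ and $p_s^-=(1-\tau_s)\pi+(1-\alpha_s)(1-\pi)$, $$L_s(\pi)=p_s^+\min[U_s(\pi,1),1-U_s(\pi,1)]+p_s^-\min[U_s(\pi,0),1-U_s(\pi,0)],$$ where a summand with zero observation probability is taken to be $0$. *)

theory Defs
  imports "HOL-Probability.Probability"
begin

text \<open>Hidden states and observations both live in \<open>{0, 1}\<close> and are encoded by \<open>bool\<close>
  (\<open>False\<close> is 0, \<open>True\<close> is 1). A transition kernel on \<open>{0, 1}\<close> is a function
  \<open>A :: bool \<Rightarrow> bool pmf\<close>, with \<open>a\<^sub>i\<^sub>j = pmf (A i) j\<close>.\<close>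

datatype sensor = Cheap | Expensive

text \<open>\<open>obs_pmf \<alpha> \<tau> s z\<close> is the law of the observation of sensor \<open>s\<close> in state \<open>z\<close>; it is used
  only for \<open>\<alpha> s, \<tau> s \<in> [0, 1]\<close>, where \<open>bernoulli_pmf\<close> does not truncate its argument.\<close>

definition obs_pmf :: "(sensor \<Rightarrow> real) \<Rightarrow> (sensor \<Rightarrow> real) \<Rightarrow> sensor \<Rightarrow> bool \<Rightarrow> bool pmf" where
  "obs_pmf \<alpha> \<tau> s z = bernoulli_pmf (if z then \<tau> s else \<alpha> s)"

definition obs_matrix :: "(sensor \<Rightarrow> real) \<Rightarrow> (sensor \<Rightarrow> real) \<Rightarrow> sensor \<Rightarrow> real^bool^bool" where
  "obs_matrix \<alpha> \<tau> s = (\<chi> i j. pmf (obs_pmf \<alpha> \<tau> s i) j)"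

definition stochastic_matrix :: "real^'n^'m \<Rightarrow> bool" where
  "stochastic_matrix G \<longleftrightarrow> (\<forall>i j. 0 \<le> G $ i $ j) \<and> (\<forall>i. (\<Sum>j\<in>UNIV. G $ i $ j) = 1)"

definition blackwell_dominates ::
    "(sensor \<Rightarrow> real) \<Rightarrow> (sensor \<Rightarrow> real) \<Rightarrow> sensor \<Rightarrow> sensor \<Rightarrow> bool" where
  "blackwell_dominates \<alpha> \<tau> s s' \<longleftrightarrow>
     (\<exists>G. stochastic_matrix G \<and> obs_matrix \<alpha> \<tau> s' = obs_matrix \<alpha> \<tau> s ** G)"

definition predict :: "(bool \<Rightarrow> bool pmf) \<Rightarrow> real \<Rightarrow> real" where
  "predict A \<pi> = pmf (A False) True * (1 - \<pi>) + pmf (A True) True * \<pi>"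

definition obs_prob ::
    "(sensor \<Rightarrow> real) \<Rightarrow> (sensor \<Rightarrow> real) \<Rightarrow> sensor \<Rightarrow> real \<Rightarrow> bool \<Rightarrow> real" where
  "obs_prob \<alpha> \<tau> s \<pi> obs =
     (if obs then \<tau> s * \<pi> + \<alpha> s * (1 - \<pi>) else (1 - \<tau> s) * \<pi> + (1 - \<alpha> s) * (1 - \<pi>))"

text \<open>On observations of probability zero the value is \<open>0\<close>, since \<open>x / 0 = 0\<close>.\<close>

definition update ::
    "(sensor \<Rightarrow> real) \<Rightarrow> (sensor \<Rightarrow> real) \<Rightarrow> sensor \<Rightarrow> real \<Rightarrow> bool \<Rightarrow> real" where
  "update \<alpha> \<tau> s \<pi> obs =
     (if obs then \<tau> s * \<pi> / (\<tau> s * \<pi> + \<alpha> s * (1 - \<pi>))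
      else (1 - \<tau> s) * \<pi> / ((1 - \<tau> s) * \<pi> + (1 - \<alpha> s) * (1 - \<pi>)))"

definition class_error :: "real \<Rightarrow> real" where
  "class_error \<pi> = min \<pi> (1 - \<pi>)"

definition exp_post_error ::
    "(sensor \<Rightarrow> real) \<Rightarrow> (sensor \<Rightarrow> real) \<Rightarrow> sensor \<Rightarrow> real \<Rightarrow> real" where
  "exp_post_error \<alpha> \<tau> s \<pi> =
     obs_prob \<alpha> \<tau> s \<pi> True * min (update \<alpha> \<tau> s \<pi> True) (1 - update \<alpha> \<tau> s \<pi> True) +
     obs_prob \<alpha> \<tau> s \<pi> False * min (update \<alpha> \<tau> s \<pi> False) (1 - update \<alpha> \<tau> s \<pi> False)"

definition instant_cost ::
    "(sensor \<Rightarrow> real) \<Rightarrow> (sensor \<Rightarrow> real) \<Rightarrow> real \<Rightarrow> real \<Rightarrow> sensor \<Rightarrow> real" where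
  "instant_cost \<alpha> \<tau> lam \<pi> s = lam * of_bool (s = Expensive) + exp_post_error \<alpha> \<tau> s \<pi>"

definition policy :: "(real \<Rightarrow> sensor) \<Rightarrow> bool" where
  "policy \<mu> \<longleftrightarrow> \<mu> \<in> measurable (restrict_space borel {0..1}) (count_space UNIV)"

text \<open>A trajectory is a function \<open>\<omega>\<close> with \<open>\<omega> k = (z\<^sub>k, o\<^sub>k)\<close>. The predicted belief at time \<open>k\<close>
  depends only on the observations at times \<open>0, \<dots>, k - 1\<close>.\<close>

primrec pred_belief ::
    "(bool \<Rightarrow> bool pmf) \<Rightarrow> (sensor \<Rightarrow> real) \<Rightarrow> (sensor \<Rightarrow> real) \<Rightarrow> (real \<Rightarrow> sensor) \<Rightarrow> real \<Rightarrow>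
     (nat \<Rightarrow> bool \<times> bool) \<Rightarrow> nat \<Rightarrow> real" where
  "pred_belief A \<alpha> \<tau> \<mu> \<pi>0 \<omega> 0 = \<pi>0"
| "pred_belief A \<alpha> \<tau> \<mu> \<pi>0 \<omega> (Suc k) =
     predict A (update \<alpha> \<tau> (\<mu> (pred_belief A \<alpha> \<tau> \<mu> \<pi>0 \<omega> k))
                  (pred_belief A \<alpha> \<tau> \<mu> \<pi>0 \<omega> k) (snd (\<omega> k)))"

definition sensor_at ::
    "(bool \<Rightarrow> bool pmf) \<Rightarrow> (sensor \<Rightarrow> real) \<Rightarrow> (sensor \<Rightarrow> real) \<Rightarrow> (real \<Rightarrow> sensor) \<Rightarrow> real \<Rightarrow>
     (nat \<Rightarrow> bool \<times> bool) \<Rightarrow> nat \<Rightarrow> sensor" where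
  "sensor_at A \<alpha> \<tau> \<mu> \<pi>0 \<omega> k = \<mu> (pred_belief A \<alpha> \<tau> \<mu> \<pi>0 \<omega> k)"

definition post_belief ::
    "(bool \<Rightarrow> bool pmf) \<Rightarrow> (sensor \<Rightarrow> real) \<Rightarrow> (sensor \<Rightarrow> real) \<Rightarrow> (real \<Rightarrow> sensor) \<Rightarrow> real \<Rightarrow>
     (nat \<Rightarrow> bool \<times> bool) \<Rightarrow> nat \<Rightarrow> real" where
  "post_belief A \<alpha> \<tau> \<mu> \<pi>0 \<omega> k =
     update \<alpha> \<tau> (sensor_at A \<alpha> \<tau> \<mu> \<pi>0 \<omega> k) (pred_belief A \<alpha> \<tau> \<mu> \<pi>0 \<omega> k) (snd (\<omega> k))"

text \<open>Conditional law of \<open>(z\<^sub>k, o\<^sub>k)\<close> given the trajectory before time \<open>k\<close>. Here \<open>P s\<close> is the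
  transition kernel of the hidden state when sensor \<open>s\<close> is used, so a priori the dynamics may
  depend on the action; the belief filter uses the kernel \<open>A\<close>.\<close>

definition step_pmf ::
    "(sensor \<Rightarrow> bool \<Rightarrow> bool pmf) \<Rightarrow> (bool \<Rightarrow> bool pmf) \<Rightarrow> (sensor \<Rightarrow> real) \<Rightarrow> (sensor \<Rightarrow> real) \<Rightarrow>
     (real \<Rightarrow> sensor) \<Rightarrow> real \<Rightarrow> nat \<Rightarrow> (nat \<Rightarrow> bool \<times> bool) \<Rightarrow> (bool \<times> bool) pmf" where
  "step_pmf P A \<alpha> \<tau> \<mu> \<pi>0 k \<omega> =
     bind_pmf (case k of 0 \<Rightarrow> bernoulli_pmf \<pi>0
               | Suc m \<Rightarrow> P (sensor_at A \<alpha> \<tau> \<mu> \<pi>0 \<omega> m) (fst (\<omega> m)))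
       (\<lambda>z. map_pmf (Pair z) (obs_pmf \<alpha> \<tau> (sensor_at A \<alpha> \<tau> \<mu> \<pi>0 \<omega> k) z))"

abbreviation step_kernel ::
    "(sensor \<Rightarrow> bool \<Rightarrow> bool pmf) \<Rightarrow> (bool \<Rightarrow> bool pmf) \<Rightarrow> (sensor \<Rightarrow> real) \<Rightarrow> (sensor \<Rightarrow> real) \<Rightarrow>
     (real \<Rightarrow> sensor) \<Rightarrow> real \<Rightarrow> nat \<Rightarrow> (nat \<Rightarrow> bool \<times> bool) \<Rightarrow> (bool \<times> bool) measure" where
  "step_kernel P A \<alpha> \<tau> \<mu> \<pi>0 \<equiv> \<lambda>k \<omega>. measure_pmf (step_pmf P A \<alpha> \<tau> \<mu> \<pi>0 k \<omega>)"

text \<open>The law of the trajectory under policy \<open>\<mu>\<close> started from \<open>\<pi>0\<close> is the Ionescu-Tulcea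
  measure of these kernels.\<close>

definition path_measure ::
    "(sensor \<Rightarrow> bool \<Rightarrow> bool pmf) \<Rightarrow> (bool \<Rightarrow> bool pmf) \<Rightarrow> (sensor \<Rightarrow> real) \<Rightarrow> (sensor \<Rightarrow> real) \<Rightarrow>
     (real \<Rightarrow> sensor) \<Rightarrow> real \<Rightarrow> (nat \<Rightarrow> bool \<times> bool) measure" where
  "path_measure P A \<alpha> \<tau> \<mu> \<pi>0 =
     projective_family.lim UNIV
       (Ionescu_Tulcea.CI (step_kernel P A \<alpha> \<tau> \<mu> \<pi>0) (\<lambda>_. count_space UNIV))
       (\<lambda>_. count_space UNIV)"

lemma Ionescu_Tulcea_step_kernel:
  "Ionescu_Tulcea (step_kernel P A \<alpha> \<tau> \<mu> \<pi>0) (\<lambda>_. count_space UNIV)"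
proof (rule Ionescu_Tulcea.intro)
  fix k :: nat
  show "step_kernel P A \<alpha> \<tau> \<mu> \<pi>0 k
      \<in> measurable (PiM {0..<k} (\<lambda>_. count_space UNIV)) (subprob_algebra (count_space UNIV))"
    by (subst count_space_PiM_finite) (auto simp: measure_pmf_in_subprob_algebra)
next
  fix k :: nat and \<omega> :: "nat \<Rightarrow> bool \<times> bool"
  show "prob_space (step_kernel P A \<alpha> \<tau> \<mu> \<pi>0 k \<omega>)"
    by (rule measure_pmf.prob_space_axioms)
qed

lemma
  shows prob_space_path_measure: "prob_space (path_measure P A \<alpha> \<tau> \<mu> \<pi>0)"
    and sets_path_measure:
      "sets (path_measure P A \<alpha> \<tau> \<mu> \<pi>0) = sets (PiM UNIV (\<lambda>_. count_space UNIV))"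
    and emeasure_path_measure: "\<And>n X. X \<subseteq> ({0..<n} \<rightarrow>\<^sub>E UNIV) \<Longrightarrow>
      emeasure (path_measure P A \<alpha> \<tau> \<mu> \<pi>0) {\<omega>. restrict \<omega> {0..<n} \<in> X} =
      emeasure (Ionescu_Tulcea.C (step_kernel P A \<alpha> \<tau> \<mu> \<pi>0) (\<lambda>_. count_space UNIV) 0 n
        (\<lambda>_. undefined)) X"
proof -
  interpret IT: Ionescu_Tulcea "step_kernel P A \<alpha> \<tau> \<mu> \<pi>0" "\<lambda>_. count_space UNIV"
    by (rule Ionescu_Tulcea_step_kernel)
  have eq: "path_measure P A \<alpha> \<tau> \<mu> \<pi>0 = IT.PF.lim"
    by (simp add: path_measure_def)
  show s: "sets (path_measure P A \<alpha> \<tau> \<mu> \<pi>0) = sets (PiM UNIV (\<lambda>_. count_space UNIV))"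
    by (simp add: eq)
  show em: "emeasure (path_measure P A \<alpha> \<tau> \<mu> \<pi>0) {\<omega>. restrict \<omega> {0..<n} \<in> X} =
      emeasure (IT.C 0 n (\<lambda>_. undefined)) X" if "X \<subseteq> ({0..<n} \<rightarrow>\<^sub>E UNIV)" for n X
  proof -
    have X: "X \<in> sets (PiM {0..<n} (\<lambda>_. count_space (UNIV :: (bool \<times> bool) set)))"
      using that by (subst count_space_PiM_finite) auto
    have "{\<omega>. restrict \<omega> {0..<n} \<in> X} = IT.PF.emb UNIV {0..<n} X"
      by (auto simp: prod_emb_def space_PiM)
    moreover have "IT.PF.emb {0..<n} {0..<n} X = X"
      using X by (simp add: prod_emb_id sets.sets_into_space that)
    ultimately show ?thesis
      using IT.lim[OF _ X] IT.emeasure_CI[OF _ X, of n] by (simp add: eq)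
  qed
  have "emeasure (path_measure P A \<alpha> \<tau> \<mu> \<pi>0) {\<omega>. restrict \<omega> {0..<0} \<in> {\<lambda>_. undefined}} = 1"
    by (subst em) (auto simp: restrict_def PiM_empty)
  moreover have "space (path_measure P A \<alpha> \<tau> \<mu> \<pi>0) = UNIV"
    using sets_eq_imp_space_eq[OF s] by (simp add: space_PiM)
  ultimately show "prob_space (path_measure P A \<alpha> \<tau> \<mu> \<pi>0)"
    by (intro prob_spaceI) (simp add: restrict_def)
qed

definition total_cost ::
    "(sensor \<Rightarrow> bool \<Rightarrow> bool pmf) \<Rightarrow> (bool \<Rightarrow> bool pmf) \<Rightarrow> (sensor \<Rightarrow> real) \<Rightarrow> (sensor \<Rightarrow> real) \<Rightarrow>
     real \<Rightarrow> real \<Rightarrow> real \<Rightarrow> (real \<Rightarrow> sensor) \<Rightarrow> real" where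
  "total_cost P A \<alpha> \<tau> \<gamma> lam \<pi>0 \<mu> =
     (LINT \<omega>|path_measure P A \<alpha> \<tau> \<mu> \<pi>0.
        (\<Sum>k. \<gamma> ^ k * (class_error (post_belief A \<alpha> \<tau> \<mu> \<pi>0 \<omega> k) +
                       lam * of_bool (sensor_at A \<alpha> \<tau> \<mu> \<pi>0 \<omega> k = Expensive))))"

definition optimal_policy ::
    "(sensor \<Rightarrow> bool \<Rightarrow> bool pmf) \<Rightarrow> (bool \<Rightarrow> bool pmf) \<Rightarrow> (sensor \<Rightarrow> real) \<Rightarrow> (sensor \<Rightarrow> real) \<Rightarrow>
     real \<Rightarrow> real \<Rightarrow> (real \<Rightarrow> sensor) \<Rightarrow> bool" where
  "optimal_policy P A \<alpha> \<tau> \<gamma> lam \<mu> \<longleftrightarrow> policy \<mu> \<and>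
     (\<forall>\<mu>'. policy \<mu>' \<longrightarrow>
       (\<forall>\<pi>0\<in>{0..1}. total_cost P A \<alpha> \<tau> \<gamma> lam \<pi>0 \<mu> \<le> total_cost P A \<alpha> \<tau> \<gamma> lam \<pi>0 \<mu>'))"

definition expensive_region ::
    "(sensor \<Rightarrow> real) \<Rightarrow> (sensor \<Rightarrow> real) \<Rightarrow> real \<Rightarrow> real set" where
  "expensive_region \<alpha> \<tau> lam =
     {\<pi>\<in>{0..1}. instant_cost \<alpha> \<tau> lam \<pi> Expensive < instant_cost \<alpha> \<tau> lam \<pi> Cheap}"

end

theory Submission
  imports Defs
begin

text \<open>Along a trajectory the predicted belief is a Markov chain, so the cost \<open>J\<close> of a policy satisfies
  the Bellman equation of that policy. If \<open>\<mu>\<close> is optimal, changing it at one belief shows that \<open>J\<close>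
  satisfies the optimality equation; hence \<open>J\<close> is the limit of value iteration started from \<open>0\<close>,
  whose iterates are concave because the stage costs are. By concavity and Blackwell dominance the
  expected future cost after \<open>Expensive\<close> is at most that after \<open>Cheap\<close>, so where \<open>Expensive\<close>
  also has the strictly lower stage cost, choosing \<open>Cheap\<close> would violate the optimality equation.\<close>

section \<open>Expectations along a trajectory\<close>

lemma pred_belief_cong:
  assumes "\<And>k. k < n \<Longrightarrow> \<omega> k = \<omega>' k"
  shows "pred_belief A \<alpha> \<tau> \<mu> \<pi>0 \<omega> n = pred_belief A \<alpha> \<tau> \<mu> \<pi>0 \<omega>' n"
  using assms by (induction n) auto

lemma step_pmf_cong:
  assumes "\<And>k. k < n \<Longrightarrow> \<omega> k = \<omega>' k"
  shows "step_pmf P A \<alpha> \<tau> \<mu> \<pi>0 n \<omega> = step_pmf P A \<alpha> \<tau> \<mu> \<pi>0 n \<omega>'"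
proof -
  \<comment> \<open>Two instances are used: the belief at \<open>n\<close> chooses the sensor that
    is read now, the belief at \<open>n - 1\<close> the one whose transition kernel applies.\<close>
  have *: "pred_belief A \<alpha> \<tau> \<mu> \<pi>0 \<omega> m = pred_belief A \<alpha> \<tau> \<mu> \<pi>0 \<omega>' m" if "m \<le> n" for m
    by (rule pred_belief_cong) (use assms that in auto)
  show ?thesis
    using assms *[of n] *[of "n - 1"]
    by (auto simp: step_pmf_def sensor_at_def split: nat.split)
qed

lemma measurable_restrict_path_measure [measurable]:
  "(\<lambda>\<omega>. restrict \<omega> {0..<n}) \<in>
    path_measure P A \<alpha> \<tau> \<mu> \<pi>0 \<rightarrow>\<^sub>M PiM {0..<n} (\<lambda>_. count_space UNIV)"
  by (subst measurable_cong_sets[OF sets_path_measure refl]) (rule measurable_restrict_subset, simp)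

text \<open>The cylinder probabilities in \<open>emeasure_path_measure\<close> determine the law of
  the first \<open>n\<close> coordinates. Stated as an equation of measures, this transports
  integrals between the two descriptions.\<close>

lemma distr_path_measure:
  "distr (path_measure P A \<alpha> \<tau> \<mu> \<pi>0) (PiM {0..<n} (\<lambda>_. count_space UNIV))
     (\<lambda>\<omega>. restrict \<omega> {0..<n}) =
   Ionescu_Tulcea.C (step_kernel P A \<alpha> \<tau> \<mu> \<pi>0) (\<lambda>_. count_space UNIV) 0 n (\<lambda>_. undefined)"
  (is "?L = ?R")
proof -
  interpret IT: Ionescu_Tulcea "step_kernel P A \<alpha> \<tau> \<mu> \<pi>0" "\<lambda>_. count_space UNIV"
    by (rule Ionescu_Tulcea_step_kernel)
  have sC: "sets ?R = sets (PiM {0..<n} (\<lambda>_. count_space UNIV))"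
    using IT.sets_C[of "\<lambda>_. undefined" 0 n] by (simp add: space_PiM)
  have sp: "space (path_measure P A \<alpha> \<tau> \<mu> \<pi>0) = UNIV"
    using sets_eq_imp_space_eq[OF sets_path_measure] by (simp add: space_PiM)
  show ?thesis
  proof (rule measure_eqI)
    show "sets ?L = sets ?R" by (simp add: sC)
  next
    fix X assume "X \<in> sets ?L"
    then have X: "X \<in> sets (PiM {0..<n} (\<lambda>_. count_space (UNIV :: (bool \<times> bool) set)))" by simp
    then have "X \<subseteq> ({0..<n} \<rightarrow>\<^sub>E UNIV)"
      using sets.sets_into_space[OF X] by (simp add: space_PiM)
    then show "emeasure ?L X = emeasure ?R X"
      using X by (simp add: emeasure_distr sp vimage_def emeasure_path_measure)
  qed
qed

text \<open>The tower property: coordinate \<open>n\<close> is integrated out against its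
  conditional law. The hypothesis says that \<open>F\<close> reads only the coordinates up to
  \<open>n\<close>; these range over a discrete space, so it also supplies measurability.\<close>

lemma nn_integral_path_step:
  fixes F :: "(nat \<Rightarrow> bool \<times> bool) \<Rightarrow> ennreal"
  assumes F: "\<And>\<omega>. F (restrict \<omega> {0..<Suc n}) = F \<omega>"
  shows "(\<integral>\<^sup>+\<omega>. F \<omega> \<partial>path_measure P A \<alpha> \<tau> \<mu> \<pi>0) =
    (\<integral>\<^sup>+\<omega>. (\<integral>\<^sup>+x. F (fun_upd \<omega> n x) \<partial>step_pmf P A \<alpha> \<tau> \<mu> \<pi>0 n \<omega>) \<partial>path_measure P A \<alpha> \<tau> \<mu> \<pi>0)"
proof -
  interpret IT: Ionescu_Tulcea "step_kernel P A \<alpha> \<tau> \<mu> \<pi>0" "\<lambda>_. count_space UNIV"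
    by (rule Ionescu_Tulcea_step_kernel)
  let ?PM = "path_measure P A \<alpha> \<tau> \<mu> \<pi>0"
  let ?M = "\<lambda>n::nat. PiM {0..<n} (\<lambda>_. count_space (UNIV :: (bool \<times> bool) set))"
  let ?u = "\<lambda>_::nat. undefined :: bool \<times> bool"
  have M: "?M m = count_space ({0..<m} \<rightarrow>\<^sub>E UNIV)" for m :: nat
    by (rule count_space_PiM_finite) auto
  have meas: "f \<in> borel_measurable (?M m)" for f :: "_ \<Rightarrow> ennreal" and m
    by (simp add: M)
  have path: "(\<integral>\<^sup>+\<omega>. f \<omega> \<partial>?PM) = (\<integral>\<^sup>+\<omega>. f \<omega> \<partial>IT.C 0 m ?u)"
    if "\<And>\<omega>. f (restrict \<omega> {0..<m}) = f \<omega>" for f :: "_ \<Rightarrow> ennreal" and m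
  proof -
    have "(\<integral>\<^sup>+\<omega>. f \<omega> \<partial>IT.C 0 m ?u) = (\<integral>\<^sup>+\<omega>. f (restrict \<omega> {0..<m}) \<partial>?PM)"
      unfolding distr_path_measure[symmetric] by (rule nn_integral_distr[OF measurable_restrict_path_measure]) (simp add: meas)
    then show ?thesis by (simp add: that)
  qed
  have u: "?u \<in> space (?M 0)" by (simp add: space_PiM)
  have sC: "sets (IT.C 0 n ?u) = sets (?M n)"
    using IT.sets_C[of ?u 0 n] by (simp add: space_PiM)
  define G where "G \<omega> = (\<integral>\<^sup>+x. F (fun_upd \<omega> n x) \<partial>step_pmf P A \<alpha> \<tau> \<mu> \<pi>0 n \<omega>)" for \<omega>
  \<comment> \<open>The inner integral reads only coordinates below \<open>n\<close>, so the
    finite-dimensional integral can be turned back into one over whole trajectories.\<close>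
  have G: "G (restrict \<omega> {0..<n}) = G \<omega>" for \<omega>
  proof -
    have "F (fun_upd (restrict \<omega> {0..<n}) n x) = F (fun_upd \<omega> n x)" for x
    proof -
      have "restrict (fun_upd (restrict \<omega> {0..<n}) n x) {0..<Suc n} = restrict (fun_upd \<omega> n x) {0..<Suc n}"
        by (auto simp: fun_eq_iff restrict_def)
      then show ?thesis by (metis F)
    qed
    moreover have "step_pmf P A \<alpha> \<tau> \<mu> \<pi>0 n (restrict \<omega> {0..<n}) = step_pmf P A \<alpha> \<tau> \<mu> \<pi>0 n \<omega>"
      by (rule step_pmf_cong) simp
    ultimately show ?thesis by (simp add: G_def)
  qed
  have "(\<integral>\<^sup>+\<omega>. F \<omega> \<partial>?PM) = (\<integral>\<^sup>+\<omega>. F \<omega> \<partial>IT.C 0 (Suc n) ?u)"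
    by (rule path) (rule F)
  also have "\<dots> = (\<integral>\<^sup>+\<omega>. (\<integral>\<^sup>+\<omega>'. F \<omega>' \<partial>IT.eP n \<omega>) \<partial>IT.C 0 n ?u)"
    unfolding IT.C.simps
    by (subst nn_integral_bind[where B = "?M (Suc n)"])
      (auto intro!: meas simp: measurable_cong_sets[OF sC refl])
  also have "\<dots> = (\<integral>\<^sup>+\<omega>. G \<omega> \<partial>IT.C 0 n ?u)"
    by (rule nn_integral_cong, subst IT.nn_integral_eP)
      (auto intro!: meas simp: G_def sets_eq_imp_space_eq[OF sC])
  also have "\<dots> = (\<integral>\<^sup>+\<omega>. G \<omega> \<partial>?PM)"
    by (rule path[symmetric]) (rule G)
  finally show ?thesis by (simp add: G_def)
qed

section \<open>The belief as a Markov chain\<close>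

lemma nn_integral_bool_pmf:
  "(\<integral>\<^sup>+x. f x \<partial>measure_pmf p) = f True * ennreal (pmf p True) + f False * ennreal (pmf p False)"
  for p :: "bool pmf"
  by (simp add: nn_integral_measure_pmf nn_integral_count_space_finite UNIV_bool mult.commute add.commute)

lemma nn_integral_ennreal_bool_pmf:
  fixes p :: "bool pmf" and f :: "bool \<Rightarrow> real"
  assumes "\<And>x. 0 \<le> f x"
  shows "(\<integral>\<^sup>+x. ennreal (f x) \<partial>measure_pmf p) = ennreal (f True * pmf p True + f False * pmf p False)"
  using assms by (simp add: nn_integral_bool_pmf flip: ennreal_mult ennreal_plus)

lemma integral_bool_pmf:
  fixes p :: "bool pmf" and f :: "bool \<Rightarrow> real"
  shows "(\<integral>x. f x \<partial>measure_pmf p) = f True * pmf p True + f False * pmf p False"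
  by (subst integral_measure_pmf_real[of UNIV]) (auto simp: UNIV_bool)

lemma pmf_map_Pair: "pmf (map_pmf (Pair x) p) (y, z) = (if x = y then pmf p z else 0)"
proof (cases "x = y")
  case True
  then show ?thesis by (simp add: pmf_map_inj' inj_def)
next
  case False
  then show ?thesis by (auto intro!: pmf_map_outside)
qed

lemma pmf_bool_False: "pmf p False = 1 - pmf p True" for p :: "bool pmf"
  using sum_pmf_eq_1[OF finite subset_UNIV, of p] by (simp add: UNIV_bool)

section \<open>One step of the Bayes filter\<close>

locale sensor_model =
  fixes A :: "bool \<Rightarrow> bool pmf" and \<alpha> \<tau> :: "sensor \<Rightarrow> real"
  assumes alpha: "\<alpha> s \<in> {0..1}" and tau: "\<tau> s \<in> {0..1}"
begin

text \<open>Probability of reading \<open>y\<close> in state 1. Times the prior, it is the numerator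
  of Bayes' rule for both readings at once.\<close>

definition likelihood_one :: "sensor \<Rightarrow> bool \<Rightarrow> real" where
  "likelihood_one s y = (if y then \<tau> s else 1 - \<tau> s)"

lemma likelihood_one_bounds: "0 \<le> likelihood_one s y" "likelihood_one s y \<le> 1"
  using tau[of s] by (auto simp: likelihood_one_def)

lemma obs_prob_bounds:
  assumes "\<pi> \<in> {0..1}"
  shows "0 \<le> obs_prob \<alpha> \<tau> s \<pi> y" and "likelihood_one s y * \<pi> \<le> obs_prob \<alpha> \<tau> s \<pi> y"
  using assms alpha[of s] tau[of s] by (auto simp: obs_prob_def likelihood_one_def)

lemma update_eq: "update \<alpha> \<tau> s \<pi> y = likelihood_one s y * \<pi> / obs_prob \<alpha> \<tau> s \<pi> y"
  by (simp add: update_def obs_prob_def likelihood_one_def)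

text \<open>Bayes' rule with the denominator cleared. It survives a reading of probability zero
  because the numerator lies between 0 and the denominator.\<close>

lemma obs_prob_update:
  assumes "\<pi> \<in> {0..1}"
  shows "obs_prob \<alpha> \<tau> s \<pi> y * update \<alpha> \<tau> s \<pi> y = likelihood_one s y * \<pi>"
proof (cases "obs_prob \<alpha> \<tau> s \<pi> y = 0")
  case True
  moreover have "0 \<le> likelihood_one s y * \<pi>" using assms likelihood_one_bounds[of s y] by simp
  ultimately show ?thesis
    using obs_prob_bounds(2)[OF assms, of s y] by (metis antisym mult_zero_left)
qed (simp add: update_eq)

lemma obs_prob_sum: "obs_prob \<alpha> \<tau> s \<pi> True + obs_prob \<alpha> \<tau> s \<pi> False = 1"
  by (simp add: obs_prob_def algebra_simps)

text \<open>The numerator lies between 0 and the denominator; a reading of probability zero gives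
  the default value 0, still in the interval.\<close>

lemma update_bounds:
  assumes "\<pi> \<in> {0..1}"
  shows "update \<alpha> \<tau> s \<pi> y \<in> {0..1}"
proof -
  have "0 \<le> likelihood_one s y * \<pi>" using assms likelihood_one_bounds[of s y] by simp
  then show ?thesis
    using obs_prob_bounds[OF assms, of s y] by (auto simp: update_eq divide_le_eq_1)
qed

lemma predict_bounds:
  assumes "\<pi> \<in> {0..1}"
  shows "predict A \<pi> \<in> {0..1}"
  using convex_bound_le[of "pmf (A False) True" 1 "pmf (A True) True" "1 - \<pi>" \<pi>] assms
  by (simp add: predict_def pmf_le_1 mult.commute)

definition next_belief :: "sensor \<Rightarrow> real \<Rightarrow> bool \<Rightarrow> real" where
  "next_belief s \<pi> y = predict A (update \<alpha> \<tau> s \<pi> y)"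

lemma next_belief_bounds: "\<pi> \<in> {0..1} \<Longrightarrow> next_belief s \<pi> y \<in> {0..1}"
  by (simp only: next_belief_def predict_bounds update_bounds)

lemma pred_belief_bounds:
  "\<pi>0 \<in> {0..1} \<Longrightarrow> pred_belief A \<alpha> \<tau> \<mu> \<pi>0 \<omega> n \<in> {0..1}"
  by (induction n) (auto simp only: pred_belief.simps predict_bounds update_bounds)

lemma pmf_obs_pmf:
  "pmf (obs_pmf \<alpha> \<tau> s True) y = likelihood_one s y"
  "pmf (obs_pmf \<alpha> \<tau> s False) y = (if y then \<alpha> s else 1 - \<alpha> s)"
  using alpha[of s] tau[of s] by (cases y; simp add: obs_pmf_def likelihood_one_def)+

lemma obs_prob_eq:
  "obs_prob \<alpha> \<tau> s \<pi> y =
    pmf (obs_pmf \<alpha> \<tau> s True) y * \<pi> + pmf (obs_pmf \<alpha> \<tau> s False) y * (1 - \<pi>)"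
  by (simp add: pmf_obs_pmf obs_prob_def likelihood_one_def)

text \<open>Given the reading \<open>y\<close>, the state is 1 with probability
  \<open>update\<close>, and mixing the rows of \<open>A\<close> with these weights gives the law of
  the next state. So drawing the next state from the true state or from the belief gives the same
  joint law with \<open>y\<close>.\<close>

lemma bayes_filter_step:
  assumes "\<pi> \<in> {0..1}"
  shows "bind_pmf (bernoulli_pmf \<pi>) (\<lambda>z. bind_pmf (obs_pmf \<alpha> \<tau> s z) (\<lambda>y. map_pmf (Pair y) (A z))) =
    bind_pmf (bernoulli_pmf \<pi>) (\<lambda>z. bind_pmf (obs_pmf \<alpha> \<tau> s z)
      (\<lambda>y. map_pmf (Pair y) (bernoulli_pmf (next_belief s \<pi> y))))"
proof (rule pmf_eqI, clarify)
  fix y z'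
  let ?q = "\<lambda>z. pmf (obs_pmf \<alpha> \<tau> s z) y"
  let ?u = "update \<alpha> \<tau> s \<pi> y"
  have nb: "next_belief s \<pi> y \<in> {0..1}" by (rule next_belief_bounds[OF assms])
  have b: "pmf (bernoulli_pmf (next_belief s \<pi> y)) z' = pmf (A True) z' * ?u + pmf (A False) z' * (1 - ?u)"
    using nb by (cases z') (auto simp: next_belief_def predict_def pmf_bool_False[of "A _"] algebra_simps)
  have u: "obs_prob \<alpha> \<tau> s \<pi> y * ?u = ?q True * \<pi>"
    using obs_prob_update[OF assms] by (simp add: pmf_obs_pmf)
  then have c: "obs_prob \<alpha> \<tau> s \<pi> y * (1 - ?u) = ?q False * (1 - \<pi>)"
    by (simp add: obs_prob_eq algebra_simps)
  have "(?q True * \<pi>) * pmf (A True) z' + (?q False * (1 - \<pi>)) * pmf (A False) z' =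
      obs_prob \<alpha> \<tau> s \<pi> y * pmf (bernoulli_pmf (next_belief s \<pi> y)) z'"
    by (simp only: b distrib_left mult.left_commute[of "obs_prob \<alpha> \<tau> s \<pi> y"] u c, simp add: mult_ac)
  then show "pmf (bind_pmf (bernoulli_pmf \<pi>) (\<lambda>z. bind_pmf (obs_pmf \<alpha> \<tau> s z)
        (\<lambda>y. map_pmf (Pair y) (A z)))) (y, z') =
      pmf (bind_pmf (bernoulli_pmf \<pi>) (\<lambda>z. bind_pmf (obs_pmf \<alpha> \<tau> s z)
      (\<lambda>y. map_pmf (Pair y) (bernoulli_pmf (next_belief s \<pi> y))))) (y, z')"
    using assms
    by (cases y) (simp_all add: pmf_bind integral_bool_pmf pmf_map_Pair obs_prob_eq algebra_simps)
qed

section \<open>The filter along a trajectory\<close>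

abbreviation path :: "(real \<Rightarrow> sensor) \<Rightarrow> real \<Rightarrow> (nat \<Rightarrow> bool \<times> bool) measure" where
  "path \<equiv> path_measure (\<lambda>_. A) A \<alpha> \<tau>"

abbreviation belief :: "(real \<Rightarrow> sensor) \<Rightarrow> real \<Rightarrow> (nat \<Rightarrow> bool \<times> bool) \<Rightarrow> nat \<Rightarrow> real" where
  "belief \<equiv> pred_belief A \<alpha> \<tau>"

text \<open>Given the observations before time \<open>n\<close>, the state \<open>z\<^sub>n\<close> is 1 with probability \<open>\<pi>\<^sub>n\<^sup>-\<close>.\<close>

lemma nn_integral_path_filter:
  fixes F :: "real \<Rightarrow> bool \<Rightarrow> bool \<Rightarrow> ennreal"
  assumes \<pi>0: "\<pi>0 \<in> {0..1}"
  shows "(\<integral>\<^sup>+\<omega>. F (belief \<mu> \<pi>0 \<omega> n) (fst (\<omega> n)) (snd (\<omega> n)) \<partial>path \<mu> \<pi>0) =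
    (\<integral>\<^sup>+\<omega>. (\<integral>\<^sup>+z. (\<integral>\<^sup>+y. F (belief \<mu> \<pi>0 \<omega> n) z y \<partial>obs_pmf \<alpha> \<tau> (\<mu> (belief \<mu> \<pi>0 \<omega> n)) z)
        \<partial>bernoulli_pmf (belief \<mu> \<pi>0 \<omega> n)) \<partial>path \<mu> \<pi>0)"
proof (induction n arbitrary: F)
  case 0
  show ?case
    by (subst nn_integral_path_step[where n = 0]) (auto simp: step_pmf_def sensor_at_def)
next
  case (Suc n)
  let ?b = "\<lambda>\<omega>. belief \<mu> \<pi>0 \<omega>"
  let ?nb = "\<lambda>\<pi> y. next_belief (\<mu> \<pi>) \<pi> y"
  \<comment> \<open>\<open>H\<close> integrates out the reading at time \<open>n + 1\<close>, which
    leaves the belief and the reading at time \<open>n\<close> and the state at time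
    \<open>n + 1\<close>.\<close>
  define H where "H \<pi> y z' = (\<integral>\<^sup>+y'. F (?nb \<pi> y) z' y' \<partial>obs_pmf \<alpha> \<tau> (\<mu> (?nb \<pi> y)) z')" for \<pi> y z'
  have Suc_b: "?b \<omega> (Suc n) = ?nb (?b \<omega> n) (snd (\<omega> n))" for \<omega>
    by (simp add: next_belief_def)
  have upd: "?b (fun_upd \<omega> (Suc n) x) (Suc n) = ?b \<omega> (Suc n)" for \<omega> x
    by (rule pred_belief_cong) simp
  have res: "?b (restrict \<omega> {0..<Suc (Suc n)}) (Suc n) = ?b \<omega> (Suc n)" for \<omega>
    by (rule pred_belief_cong) simp
  have filt: "(\<integral>\<^sup>+z. \<integral>\<^sup>+y. \<integral>\<^sup>+z'. H \<pi> y z' \<partial>A z \<partial>obs_pmf \<alpha> \<tau> (\<mu> \<pi>) z \<partial>bernoulli_pmf \<pi>) =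
      (\<integral>\<^sup>+z. \<integral>\<^sup>+y. \<integral>\<^sup>+z'. H \<pi> y z' \<partial>bernoulli_pmf (?nb \<pi> y) \<partial>obs_pmf \<alpha> \<tau> (\<mu> \<pi>) z \<partial>bernoulli_pmf \<pi>)"
    if "\<pi> \<in> {0..1}" for \<pi>
    using arg_cong[OF bayes_filter_step[OF that, of "\<mu> \<pi>"],
        of "\<lambda>p. \<integral>\<^sup>+x. H \<pi> (fst x) (snd x) \<partial>measure_pmf p"]
    by simp
  have "(\<integral>\<^sup>+\<omega>. F (?b \<omega> (Suc n)) (fst (\<omega> (Suc n))) (snd (\<omega> (Suc n))) \<partial>path \<mu> \<pi>0) =
    (\<integral>\<^sup>+\<omega>. (\<integral>\<^sup>+z'. H (?b \<omega> n) (snd (\<omega> n)) z' \<partial>A (fst (\<omega> n))) \<partial>path \<mu> \<pi>0)"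
    by (subst nn_integral_path_step[where n = "Suc n"])
      (simp_all only: res upd fun_upd_same, simp_all add: step_pmf_def sensor_at_def H_def[abs_def] next_belief_def)
  \<comment> \<open>The induction hypothesis turns the state at time \<open>n\<close> into a
    Bernoulli draw from the belief, the form in which the one-step filter applies.\<close>
  also have "\<dots> = (\<integral>\<^sup>+\<omega>. (\<integral>\<^sup>+z. \<integral>\<^sup>+y. \<integral>\<^sup>+z'. H (?b \<omega> n) y z' \<partial>A z
      \<partial>obs_pmf \<alpha> \<tau> (\<mu> (?b \<omega> n)) z \<partial>bernoulli_pmf (?b \<omega> n)) \<partial>path \<mu> \<pi>0)"
    by (rule Suc[of "\<lambda>\<pi> z y. \<integral>\<^sup>+z'. H \<pi> y z' \<partial>A z"])
  also have "\<dots> = (\<integral>\<^sup>+\<omega>. (\<integral>\<^sup>+z. \<integral>\<^sup>+y. \<integral>\<^sup>+z'. H (?b \<omega> n) y z' \<partial>bernoulli_pmf (?nb (?b \<omega> n) y)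
      \<partial>obs_pmf \<alpha> \<tau> (\<mu> (?b \<omega> n)) z \<partial>bernoulli_pmf (?b \<omega> n)) \<partial>path \<mu> \<pi>0)"
    by (simp only: filt pred_belief_bounds[OF \<pi>0])
  \<comment> \<open>The integrand no longer depends on the state at time \<open>n\<close>, so the
    induction hypothesis can be used again, from right to left.\<close>
  also have "\<dots> = (\<integral>\<^sup>+\<omega>. (\<integral>\<^sup>+z'. H (?b \<omega> n) (snd (\<omega> n)) z'
      \<partial>bernoulli_pmf (?nb (?b \<omega> n) (snd (\<omega> n)))) \<partial>path \<mu> \<pi>0)"
    by (rule Suc[of "\<lambda>\<pi> z y. \<integral>\<^sup>+z'. H \<pi> y z' \<partial>bernoulli_pmf (?nb \<pi> y)", symmetric])
  finally show ?case
    by (simp only: Suc_b H_def)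
qed

section \<open>Transition operators of the belief chain\<close>

definition expect_obs :: "sensor \<Rightarrow> (bool \<Rightarrow> real) \<Rightarrow> real \<Rightarrow> real" where
  "expect_obs s g \<pi> = obs_prob \<alpha> \<tau> s \<pi> True * g True + obs_prob \<alpha> \<tau> s \<pi> False * g False"

text \<open>Averaging the filter identity over the hidden state leaves a reading with law
  \<open>obs_prob\<close>; from here on beliefs and readings suffice.\<close>

lemma nn_integral_path_expect_obs:
  assumes \<pi>0: "\<pi>0 \<in> {0..1}" and g: "\<And>\<pi> y. \<pi> \<in> {0..1} \<Longrightarrow> 0 \<le> g \<pi> y"
  shows "(\<integral>\<^sup>+\<omega>. ennreal (g (belief \<mu> \<pi>0 \<omega> n) (snd (\<omega> n))) \<partial>path \<mu> \<pi>0) =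
    (\<integral>\<^sup>+\<omega>. ennreal (expect_obs (\<mu> (belief \<mu> \<pi>0 \<omega> n)) (g (belief \<mu> \<pi>0 \<omega> n)) (belief \<mu> \<pi>0 \<omega> n))
      \<partial>path \<mu> \<pi>0)"
proof -
  have "(\<integral>\<^sup>+z. \<integral>\<^sup>+y. ennreal (g \<pi> y) \<partial>obs_pmf \<alpha> \<tau> s z \<partial>bernoulli_pmf \<pi>) = ennreal (expect_obs s (g \<pi>) \<pi>)"
    if "\<pi> \<in> {0..1}" for s \<pi>
    using that g[OF that]
    by (simp add: nn_integral_ennreal_bool_pmf expect_obs_def obs_prob_eq algebra_simps
        del: ennreal_plus)
  then show ?thesis
    using nn_integral_path_filter[OF \<pi>0, where F = "\<lambda>\<pi> z y. ennreal (g \<pi> y)" and \<mu> = \<mu> and n = n]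
    by (simp only: pred_belief_bounds[OF \<pi>0])
qed

definition future :: "sensor \<Rightarrow> (real \<Rightarrow> real) \<Rightarrow> real \<Rightarrow> real" where
  "future s v \<pi> = expect_obs s (\<lambda>y. v (next_belief s \<pi> y)) \<pi>"

text \<open>The Markov operator of the belief chain under \<mu>; its \<open>n\<close>-th power gives
  expectations at time \<open>n\<close>.\<close>

definition policy_step :: "(real \<Rightarrow> sensor) \<Rightarrow> (real \<Rightarrow> real) \<Rightarrow> real \<Rightarrow> real" where
  "policy_step \<mu> v \<pi> = future (\<mu> \<pi>) v \<pi>"

lemma future_mono:
  assumes "\<pi> \<in> {0..1}" and "\<And>x. x \<in> {0..1} \<Longrightarrow> v x \<le> w x"
  shows "future s v \<pi> \<le> future s w \<pi>"
  unfolding future_def expect_obs_def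
  by (intro add_mono mult_left_mono assms next_belief_bounds obs_prob_bounds)

lemma expect_obs_const: "expect_obs s (\<lambda>_. c) \<pi> = c"
  using obs_prob_sum[of s \<pi>] by (simp add: expect_obs_def flip: distrib_right)

lemma future_const: "future s (\<lambda>_. c) \<pi> = c"
  by (simp add: future_def expect_obs_const)

lemma future_diff: "future s (\<lambda>x. v x - w x) \<pi> = future s v \<pi> - future s w \<pi>"
  by (simp add: future_def expect_obs_def algebra_simps)

lemma future_bounds:
  assumes "\<pi> \<in> {0..1}" and "\<And>x. x \<in> {0..1} \<Longrightarrow> a \<le> v x \<and> v x \<le> b"
  shows "a \<le> future s v \<pi>" and "future s v \<pi> \<le> b"
  using future_mono[OF assms(1), of "\<lambda>_. a" v s] future_mono[OF assms(1), of v "\<lambda>_. b" s] assms(2)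
  by (auto simp: future_const)

lemma policy_step_pow_bounds:
  assumes "\<pi> \<in> {0..1}" and "\<And>x. x \<in> {0..1} \<Longrightarrow> a \<le> v x \<and> v x \<le> b"
  shows "a \<le> (policy_step \<mu> ^^ n) v \<pi> \<and> (policy_step \<mu> ^^ n) v \<pi> \<le> b"
  using assms(1)
proof (induction n arbitrary: \<pi>)
  case (Suc n)
  show ?case
    using future_bounds[OF Suc.prems Suc.IH] by (simp add: policy_step_def)
qed (use assms in auto)

text \<open>The last time step is removed and absorbed into \<open>v\<close>, which is why the
  induction runs over all nonnegative \<open>v\<close>.\<close>

lemma nn_integral_path_belief:
  assumes \<pi>0: "\<pi>0 \<in> {0..1}" and v: "\<And>x. x \<in> {0..1} \<Longrightarrow> 0 \<le> v x"
  shows "(\<integral>\<^sup>+\<omega>. ennreal (v (belief \<mu> \<pi>0 \<omega> n)) \<partial>path \<mu> \<pi>0) = ennreal ((policy_step \<mu> ^^ n) v \<pi>0)"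
  using v
proof (induction n arbitrary: v)
  case 0
  interpret prob_space "path \<mu> \<pi>0" by (rule prob_space_path_measure)
  show ?case by (simp add: emeasure_space_1)
next
  case (Suc n)
  have "(\<integral>\<^sup>+\<omega>. ennreal (v (belief \<mu> \<pi>0 \<omega> (Suc n))) \<partial>path \<mu> \<pi>0) =
      (\<integral>\<^sup>+\<omega>. ennreal (policy_step \<mu> v (belief \<mu> \<pi>0 \<omega> n)) \<partial>path \<mu> \<pi>0)"
    using nn_integral_path_expect_obs[OF \<pi>0, where g = "\<lambda>\<pi> y. v (next_belief (\<mu> \<pi>) \<pi> y)",
        OF Suc.prems[OF next_belief_bounds], of \<mu> n]
    by (simp add: policy_step_def future_def next_belief_def)
  also have "\<dots> = ennreal ((policy_step \<mu> ^^ n) (policy_step \<mu> v) \<pi>0)"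
    by (rule Suc.IH) (use future_mono[of _ "\<lambda>_. 0" v] Suc.prems in \<open>auto simp: policy_step_def future_const\<close>)
  finally show ?case by (simp add: funpow_swap1)
qed

text \<open>The first \<open>n\<close> coordinates range over a discrete space, on which every
  function is measurable.\<close>

lemma measurable_path_finite:
  fixes f :: "(nat \<Rightarrow> bool \<times> bool) \<Rightarrow> real"
  assumes "\<And>\<omega>. f (restrict \<omega> {0..<n}) = f \<omega>"
  shows "f \<in> borel_measurable (path \<mu> \<pi>0)"
proof -
  have M: "PiM {0..<n} (\<lambda>_. count_space (UNIV :: (bool \<times> bool) set)) = count_space ({0..<n} \<rightarrow>\<^sub>E UNIV)"
    by (rule count_space_PiM_finite) auto
  have "(\<lambda>\<omega>. f (restrict \<omega> {0..<n})) \<in> borel_measurable (path \<mu> \<pi>0)"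
    by (rule measurable_compose[OF measurable_restrict_path_measure[where n = n]]) (simp add: M)
  then show ?thesis by (simp add: assms)
qed

section \<open>Concavity and the Blackwell order\<close>

text \<open>Combining two posteriors \<open>u1\<close>, \<open>u2\<close> with weights \<open>a\<close>, \<open>b\<close> into one posterior \<open>u\<close> of weight
  \<open>a + b\<close>. This one inequality gives both the concavity of \<open>future s v\<close> and its monotonicity in
  the Blackwell order.\<close>

lemma concave_predict_combine:
  assumes v: "concave_on {0..1} v" and "0 \<le> a" "0 \<le> b"
    and "u \<in> {0..1}" and u1: "u1 \<in> {0..1}" and u2: "u2 \<in> {0..1}"
    and u: "(a + b) * u = a * u1 + b * u2"
  shows "a * v (predict A u1) + b * v (predict A u2) \<le> (a + b) * v (predict A u)"
proof (cases "a + b = 0")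
  case True
  then show ?thesis using assms by (simp add: add_nonneg_eq_0_iff)
next
  case False
  then have pos: "a + b > 0" using assms by simp
  let ?r = "a / (a + b)" and ?t = "b / (a + b)"
  have rt: "?r + ?t = 1" "0 \<le> ?r" "0 \<le> ?t" using assms pos by (auto simp flip: add_divide_distrib)
  \<comment> \<open>Division by \<open>a + b\<close> shows \<open>u\<close> as a convex combination
    of \<open>u1\<close> and \<open>u2\<close>. Since \<open>predict A\<close> is affine, the
    predicted beliefs combine with the same weights.\<close>
  have "u = ?r * u1 + ?t * u2"
    using pos by (simp flip: u add_divide_distrib)
  moreover have "predict A (?r * u1 + ?t * u2) = ?r * predict A u1 + ?t * predict A u2"
  proof -
    have t: "?t = 1 - ?r" using rt by simp
    show ?thesis unfolding t predict_def by (simp add: algebra_simps)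
  qed
  ultimately have "?r * v (predict A u1) + ?t * v (predict A u2) \<le> v (predict A u)"
    using v[unfolded concave_on_iff real_scaleR_def, THEN conjunct2, rule_format,
        OF predict_bounds[OF u1] predict_bounds[OF u2] rt(2,3,1)] by (simp only:)
  then have "(a + b) * (?r * v (predict A u1) + ?t * v (predict A u2)) \<le> (a + b) * v (predict A u)"
    using pos by (intro mult_left_mono) auto
  then show ?thesis using pos by (simp add: distrib_left)
qed

text \<open>For each reading, \<open>obs_prob\<close> and its product with \<open>update\<close> are
  affine in the prior, so the posterior of a mixed prior is a reweighted mixture of
  posteriors.\<close>

lemma concave_on_future:
  assumes v: "concave_on {0..1} v"
  shows "concave_on {0..1} (future s v)"
  unfolding concave_on_iff
proof (intro conjI ballI allI impI)
  fix x y r t :: real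
  assume x: "x \<in> {0..1}" and y: "y \<in> {0..1}" and rt: "0 \<le> r" "0 \<le> t" "r + t = 1"
  let ?z = "r * x + t * y"
  have z: "?z \<in> {0..1}"
    using convexD[of "{0..1::real}" x y r t] x y rt by simp
  have t: "t = 1 - r" using rt by simp
  have p: "obs_prob \<alpha> \<tau> s ?z ob = r * obs_prob \<alpha> \<tau> s x ob + t * obs_prob \<alpha> \<tau> s y ob" for ob
    unfolding t by (simp add: obs_prob_def algebra_simps)
  have "r * obs_prob \<alpha> \<tau> s x ob * v (next_belief s x ob) + t * obs_prob \<alpha> \<tau> s y ob * v (next_belief s y ob)
      \<le> obs_prob \<alpha> \<tau> s ?z ob * v (next_belief s ?z ob)" for ob
    unfolding next_belief_def p
  \<comment> \<open>The weights are the joint probabilities of picking the prior \<open>x\<close> or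
    \<open>y\<close> and then reading \<open>ob\<close>.\<close>
  proof (rule concave_predict_combine[OF v])
    show "(r * obs_prob \<alpha> \<tau> s x ob + t * obs_prob \<alpha> \<tau> s y ob) * update \<alpha> \<tau> s ?z ob =
        r * obs_prob \<alpha> \<tau> s x ob * update \<alpha> \<tau> s x ob + t * obs_prob \<alpha> \<tau> s y ob * update \<alpha> \<tau> s y ob"
      unfolding p[symmetric] mult.assoc obs_prob_update[OF x] obs_prob_update[OF y] obs_prob_update[OF z]
      by (simp add: algebra_simps)
  qed (use x y z rt in \<open>simp_all only: update_bounds obs_prob_bounds mult_nonneg_nonneg\<close>)
  from add_mono[OF this[of True] this[of False]]
  show "r * future s v x + t * future s v y \<le> future s v (r *\<^sub>R x + t *\<^sub>R y)"
    by (simp add: future_def expect_obs_def algebra_simps)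
qed simp

text \<open>A reading of \<open>s'\<close> is a garbled reading of \<open>s\<close>, so each
  posterior under \<open>s'\<close> averages posteriors under \<open>s\<close>; Jensen's inequality
  for the concave \<open>v\<close> makes the coarser sensor the costlier one.\<close>

lemma blackwell_future_le:
  assumes v: "concave_on {0..1} v" and bw: "blackwell_dominates \<alpha> \<tau> s s'" and \<pi>: "\<pi> \<in> {0..1}"
  shows "future s v \<pi> \<le> future s' v \<pi>"
proof -
  obtain G where G: "stochastic_matrix G" and O: "obs_matrix \<alpha> \<tau> s' = obs_matrix \<alpha> \<tau> s ** G"
    using bw by (auto simp: blackwell_dominates_def)
  have G0: "0 \<le> G $ i $ j" and G1: "G $ i $ True + G $ i $ False = 1" for i j
    using G by (auto simp: stochastic_matrix_def UNIV_bool add.commute)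
  let ?p = "obs_prob \<alpha> \<tau> s \<pi>" and ?u = "update \<alpha> \<tau> s \<pi>"
  have q: "pmf (obs_pmf \<alpha> \<tau> s' i) j =
      pmf (obs_pmf \<alpha> \<tau> s i) True * G $ True $ j + pmf (obs_pmf \<alpha> \<tau> s i) False * G $ False $ j" for i j
    using arg_cong[OF O, of "\<lambda>M. M $ i $ j"]
    by (simp add: obs_matrix_def matrix_matrix_mult_def UNIV_bool add.commute)
  have p: "obs_prob \<alpha> \<tau> s' \<pi> j = G $ True $ j * ?p True + G $ False $ j * ?p False" for j
    unfolding obs_prob_eq q by (simp add: algebra_simps)
  have l: "likelihood_one s' j = G $ True $ j * likelihood_one s True + G $ False $ j * likelihood_one s False" for j
    using q[of True j] by (simp add: pmf_obs_pmf mult.commute)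
  have "G $ True $ j * ?p True * v (next_belief s \<pi> True) + G $ False $ j * ?p False * v (next_belief s \<pi> False)
      \<le> obs_prob \<alpha> \<tau> s' \<pi> j * v (next_belief s' \<pi> j)" for j
    unfolding next_belief_def p
  \<comment> \<open>The weights are the probabilities that \<open>s\<close> reads
    \<open>True\<close> or \<open>False\<close> and that this is garbled into
    \<open>j\<close>.\<close>
  proof (rule concave_predict_combine[OF v])
    show "(G $ True $ j * ?p True + G $ False $ j * ?p False) * update \<alpha> \<tau> s' \<pi> j =
        G $ True $ j * ?p True * ?u True + G $ False $ j * ?p False * ?u False"
      unfolding p[symmetric] mult.assoc obs_prob_update[OF \<pi>] l by (simp add: algebra_simps)
  qed (use \<pi> in \<open>simp_all only: update_bounds obs_prob_bounds G0 mult_nonneg_nonneg\<close>)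
  \<comment> \<open>Summing over the garbled reading \<open>j\<close> leaves the row sums of
    \<open>G\<close>, which are 1.\<close>
  from add_mono[OF this[of True] this[of False]]
  have "(G $ True $ True + G $ True $ False) * (?p True * v (next_belief s \<pi> True)) +
      (G $ False $ True + G $ False $ False) * (?p False * v (next_belief s \<pi> False)) \<le> future s' v \<pi>"
    by (simp add: future_def expect_obs_def algebra_simps)
  then show ?thesis by (simp add: G1 future_def expect_obs_def)
qed

end

section \<open>Optimality equation\<close>

lemma concave_on_min:
  fixes f g :: "real \<Rightarrow> real"
  assumes "concave_on S f" and "concave_on S g"
  shows "concave_on S (\<lambda>x. min (f x) (g x))"
  unfolding concave_on_iff
proof (intro conjI ballI allI impI)
  show "convex S" using assms(1) by (simp add: concave_on_iff)
  fix x y u v :: real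
  assume xy: "x \<in> S" "y \<in> S" and uv: "0 \<le> u" "0 \<le> v" "u + v = 1"
  have "u * min (f x) (g x) + v * min (f y) (g y) \<le> h (u *\<^sub>R x + v *\<^sub>R y)"
    if "concave_on S h" "min (f x) (g x) \<le> h x" "min (f y) (g y) \<le> h y" for h
  proof -
    have "u * min (f x) (g x) + v * min (f y) (g y) \<le> u * h x + v * h y"
      using that uv by (intro add_mono mult_left_mono)
    also have "\<dots> \<le> h (u *\<^sub>R x + v *\<^sub>R y)"
      using that(1) xy uv unfolding concave_on_iff by blast
    finally show ?thesis .
  qed
  from this[OF assms(1)] this[OF assms(2)]
  show "u * min (f x) (g x) + v * min (f y) (g y)
      \<le> min (f (u *\<^sub>R x + v *\<^sub>R y)) (g (u *\<^sub>R x + v *\<^sub>R y))"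
    by simp
qed

section \<open>Discounted cost of a policy and its Bellman equation\<close>

locale discounted_model = sensor_model +
  fixes \<gamma> lam :: real
  assumes gamma: "0 < \<gamma>" "\<gamma> < 1" and lam: "0 < lam"
begin

abbreviation cost :: "real \<Rightarrow> sensor \<Rightarrow> real" where
  "cost \<equiv> instant_cost \<alpha> \<tau> lam"

abbreviation J :: "(real \<Rightarrow> sensor) \<Rightarrow> real \<Rightarrow> real" where
  "J \<mu> \<pi> \<equiv> total_cost (\<lambda>_. A) A \<alpha> \<tau> \<gamma> lam \<pi> \<mu>"

definition stage_cost :: "sensor \<Rightarrow> real \<Rightarrow> bool \<Rightarrow> real" where
  "stage_cost s \<pi> y = class_error (update \<alpha> \<tau> s \<pi> y) + lam * of_bool (s = Expensive)"

lemma stage_cost_bounds: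
  assumes "\<pi> \<in> {0..1}"
  shows "0 \<le> stage_cost s \<pi> y" and "stage_cost s \<pi> y \<le> 1 + lam"
  using update_bounds[OF assms, of s y] lam by (auto simp: stage_cost_def class_error_def min_def of_bool_def)

text \<open>Links the cost charged along a trajectory, which depends on the posterior, to
  \<open>instant_cost\<close>, a function of the predicted belief.\<close>

lemma expect_obs_stage_cost: "expect_obs s (stage_cost s \<pi>) \<pi> = cost \<pi> s"
proof -
  have "expect_obs s (stage_cost s \<pi>) \<pi> =
      exp_post_error \<alpha> \<tau> s \<pi> + expect_obs s (\<lambda>_. lam * of_bool (s = Expensive)) \<pi>"
    by (simp add: expect_obs_def stage_cost_def exp_post_error_def class_error_def algebra_simps)
  then show ?thesis by (simp add: expect_obs_const instant_cost_def)
qed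

lemma cost_bounds:
  assumes "\<pi> \<in> {0..1}"
  shows "0 \<le> cost \<pi> s" and "cost \<pi> s \<le> 1 + lam"
proof -
  have "expect_obs s (\<lambda>_. 0) \<pi> \<le> expect_obs s (stage_cost s \<pi>) \<pi>"
    and "expect_obs s (stage_cost s \<pi>) \<pi> \<le> expect_obs s (\<lambda>_. 1 + lam) \<pi>"
    unfolding expect_obs_def
    by (intro add_mono mult_left_mono stage_cost_bounds obs_prob_bounds assms)+
  then show "0 \<le> cost \<pi> s" and "cost \<pi> s \<le> 1 + lam"
    by (simp_all only: expect_obs_stage_cost expect_obs_const)
qed

lemma summable_discounted:
  assumes "\<And>k. 0 \<le> a k \<and> a k \<le> c"
  shows "summable (\<lambda>k. \<gamma> ^ k * a k)"
proof (rule summable_comparison_test)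
  show "\<exists>N. \<forall>n\<ge>N. norm (\<gamma> ^ n * a n) \<le> \<gamma> ^ n * c"
    using assms gamma by (auto intro!: mult_left_mono)
  show "summable (\<lambda>n. \<gamma> ^ n * c)"
    using gamma by (intro summable_mult2 summable_geometric) auto
qed

lemma policy_cost_bounds:
  assumes "\<pi> \<in> {0..1}"
  shows "0 \<le> (policy_step \<mu> ^^ k) (\<lambda>x. cost x (\<mu> x)) \<pi> \<and>
    (policy_step \<mu> ^^ k) (\<lambda>x. cost x (\<mu> x)) \<pi> \<le> 1 + lam"
  by (rule policy_step_pow_bounds[OF assms]) (simp add: cost_bounds)

text \<open>All terms are nonnegative, so expectation and discounted sum can be exchanged; the
  expected cost at time \<open>k\<close> is then a power of \<open>policy_step\<close>.\<close>

lemma J_sums: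
  assumes \<pi>: "\<pi> \<in> {0..1}"
  shows "(\<lambda>k. \<gamma> ^ k * (policy_step \<mu> ^^ k) (\<lambda>x. cost x (\<mu> x)) \<pi>) sums J \<mu> \<pi>"
proof -
  let ?a = "\<lambda>k. (policy_step \<mu> ^^ k) (\<lambda>x. cost x (\<mu> x)) \<pi>"
  define b where "b \<omega> k = belief \<mu> \<pi> \<omega> k" for \<omega> k
  define f where "f \<omega> k = stage_cost (\<mu> (b \<omega> k)) (b \<omega> k) (snd (\<omega> k))" for \<omega> k
  have bin: "b \<omega> k \<in> {0..1}" for \<omega> k
    unfolding b_def by (rule pred_belief_bounds[OF \<pi>])
  have f: "0 \<le> f \<omega> k \<and> f \<omega> k \<le> 1 + lam" for \<omega> k
    by (simp add: f_def stage_cost_bounds[OF bin])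
  have Jf: "J \<mu> \<pi> = (\<integral>\<omega>. (\<Sum>k. \<gamma> ^ k * f \<omega> k) \<partial>path \<mu> \<pi>)"
    by (simp add: total_cost_def post_belief_def sensor_at_def f_def b_def stage_cost_def)
  have fm [measurable]: "(\<lambda>\<omega>. f \<omega> k) \<in> borel_measurable (path \<mu> \<pi>)" for k
  proof (rule measurable_path_finite[where n = "Suc k"])
    fix \<omega>
    have "b (restrict \<omega> {0..<Suc k}) k = b \<omega> k"
      unfolding b_def by (rule pred_belief_cong) simp
    then show "f (restrict \<omega> {0..<Suc k}) k = f \<omega> k"
      by (simp add: f_def)
  qed
  have fk: "(\<integral>\<^sup>+\<omega>. ennreal (f \<omega> k) \<partial>path \<mu> \<pi>) = ennreal (?a k)" for k
  proof -
    have "(\<integral>\<^sup>+\<omega>. ennreal (f \<omega> k) \<partial>path \<mu> \<pi>) = (\<integral>\<^sup>+\<omega>. ennreal (cost (b \<omega> k) (\<mu> (b \<omega> k))) \<partial>path \<mu> \<pi>)"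
      using nn_integral_path_expect_obs[OF \<pi>, of "\<lambda>x. stage_cost (\<mu> x) x" \<mu> k]
      by (simp add: f_def b_def stage_cost_bounds expect_obs_stage_cost)
    also have "\<dots> = ennreal (?a k)"
      unfolding b_def by (rule nn_integral_path_belief[OF \<pi>]) (rule cost_bounds)
    finally show ?thesis .
  qed
  have sa: "summable (\<lambda>k. \<gamma> ^ k * ?a k)"
    by (rule summable_discounted[OF policy_cost_bounds[OF \<pi>]])
  have nn: "0 \<le> \<gamma> ^ k * f \<omega> k" "0 \<le> \<gamma> ^ k * ?a k" for \<omega> k
    using f policy_cost_bounds[OF \<pi>] gamma by simp_all
  have sf: "summable (\<lambda>k. \<gamma> ^ k * f \<omega> k)" for \<omega>
    by (rule summable_discounted[OF f])
  have "(\<integral>\<^sup>+\<omega>. ennreal (\<Sum>k. \<gamma> ^ k * f \<omega> k) \<partial>path \<mu> \<pi>) =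
      (\<integral>\<^sup>+\<omega>. (\<Sum>k. ennreal (\<gamma> ^ k * f \<omega> k)) \<partial>path \<mu> \<pi>)"
    by (simp add: suminf_ennreal2 nn sf)
  also have "\<dots> = (\<Sum>k. \<integral>\<^sup>+\<omega>. ennreal (\<gamma> ^ k * f \<omega> k) \<partial>path \<mu> \<pi>)"
    by (rule nn_integral_suminf) simp
  also have "\<dots> = (\<Sum>k. ennreal (\<gamma> ^ k * ?a k))"
    using gamma by (simp add: ennreal_mult' nn_integral_cmult fk)
  also have "\<dots> = ennreal (\<Sum>k. \<gamma> ^ k * ?a k)"
    by (rule suminf_ennreal2[OF nn(2) sa])
  finally have "J \<mu> \<pi> = (\<Sum>k. \<gamma> ^ k * ?a k)"
    unfolding Jf by (subst integral_eq_nn_integral) (auto simp: suminf_nonneg nn sf sa)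
  with sa show ?thesis by (simp add: summable_sums)
qed

text \<open>The outermost \<open>policy_step\<close> is the first transition. Hence the series from
  time 1 on is \<gamma> times the expected series started at the next belief.\<close>

lemma J_bellman:
  assumes \<pi>: "\<pi> \<in> {0..1}"
  shows "J \<mu> \<pi> = cost \<pi> (\<mu> \<pi>) + \<gamma> * future (\<mu> \<pi>) (J \<mu>) \<pi>"
proof -
  let ?a = "\<lambda>k. (policy_step \<mu> ^^ k) (\<lambda>x. cost x (\<mu> x))"
  let ?n = "next_belief (\<mu> \<pi>) \<pi>" and ?p = "obs_prob \<alpha> \<tau> (\<mu> \<pi>) \<pi>"
  have "(\<lambda>k. \<gamma> * (?p True * (\<gamma> ^ k * ?a k (?n True)) + ?p False * (\<gamma> ^ k * ?a k (?n False)))) sums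
      (\<gamma> * (?p True * J \<mu> (?n True) + ?p False * J \<mu> (?n False)))"
    by (intro sums_mult sums_add J_sums next_belief_bounds \<pi>)
  then have "(\<lambda>k. \<gamma> ^ Suc k * ?a (Suc k) \<pi>) sums (\<gamma> * future (\<mu> \<pi>) (J \<mu>) \<pi>)"
    by (simp add: policy_step_def future_def expect_obs_def algebra_simps)
  then have "(\<lambda>k. \<gamma> ^ k * ?a k \<pi>) sums (\<gamma> * future (\<mu> \<pi>) (J \<mu>) \<pi> + cost \<pi> (\<mu> \<pi>))"
    by (subst (asm) sums_Suc_iff) simp
  then show ?thesis
    using sums_unique2[OF J_sums[OF \<pi>]] by simp
qed

text \<open>The bound is the geometric series of the largest stage cost. Being uniform in the
  policy, it serves a policy and its modification alike.\<close>

lemma J_bounded: "\<exists>M. \<forall>\<pi>\<in>{0..1}. \<forall>\<mu>. \<bar>J \<mu> \<pi>\<bar> \<le> M"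
proof (intro exI ballI allI)
  fix \<pi> :: real and \<mu> assume \<pi>: "\<pi> \<in> {0..1}"
  have g: "(\<lambda>k. \<gamma> ^ k * (1 + lam)) sums (1 / (1 - \<gamma>) * (1 + lam))"
    using gamma by (intro sums_mult2 geometric_sums) auto
  have "0 \<le> J \<mu> \<pi>"
    using gamma policy_cost_bounds[OF \<pi>] by (intro sums_le[OF _ sums_zero J_sums[OF \<pi>]]) simp
  moreover have "J \<mu> \<pi> \<le> 1 / (1 - \<gamma>) * (1 + lam)"
    using gamma policy_cost_bounds[OF \<pi>] by (intro sums_le[OF _ J_sums[OF \<pi>] g] mult_left_mono) auto
  ultimately show "\<bar>J \<mu> \<pi>\<bar> \<le> 1 / (1 - \<gamma>) * (1 + lam)" by simp
qed

text \<open>A maximum principle: feeding a bound on \<open>e\<close> into its own inequality gains a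
  factor \<gamma>, and this can be repeated indefinitely.\<close>

lemma discounted_subsolution_nonpos:
  assumes bd: "\<And>x. x \<in> {0..1} \<Longrightarrow> e x \<le> M"
    and sub: "\<And>x. x \<in> {0..1} \<Longrightarrow> e x \<le> \<gamma> * future (\<mu> x) e x"
    and \<pi>: "\<pi> \<in> {0..1}"
  shows "e \<pi> \<le> 0"
proof -
  have "e x \<le> \<gamma> ^ n * M" if "x \<in> {0..1}" for x n
    using that
  proof (induction n arbitrary: x)
    case (Suc n)
    have "future (\<mu> x) e x \<le> future (\<mu> x) (\<lambda>_. \<gamma> ^ n * M) x"
      by (rule future_mono[OF Suc.prems Suc.IH])
    then have "\<gamma> * future (\<mu> x) e x \<le> \<gamma> * (\<gamma> ^ n * M)"
      using gamma by (simp add: future_const)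
    then show ?case using sub[OF Suc.prems] by (simp add: mult.assoc)
  qed (use bd in simp)
  moreover have "(\<lambda>n. \<gamma> ^ n * M) \<longlonglongrightarrow> 0"
    using gamma by (intro tendsto_mult_left_zero LIMSEQ_power_zero) simp
  ultimately show ?thesis
    using \<pi> by (intro LIMSEQ_le_const) auto
qed

section \<open>Optimal policies and value iteration\<close>

text \<open>If deviating at the single belief \<open>\<pi>\<close> lowered the one-step lookahead, then the policy
  \<open>\<mu>(\<pi> := s)\<close> would beat \<open>\<mu>\<close>. Changing one point keeps a policy measurable, so no measurable
  selection is needed.\<close>

lemma optimal_le_deviation:
  assumes opt: "optimal_policy (\<lambda>_. A) A \<alpha> \<tau> \<gamma> lam \<mu>" and \<pi>: "\<pi> \<in> {0..1}"
  shows "J \<mu> \<pi> \<le> cost \<pi> s + \<gamma> * future s (J \<mu>) \<pi>"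
proof (rule ccontr)
  assume neg: "\<not> ?thesis"
  let ?\<mu>' = "fun_upd \<mu> \<pi> s"
  have \<mu>: "policy \<mu>" using opt by (simp add: optimal_policy_def)
  have "policy ?\<mu>'"
  proof -
    have "{x \<in> space (restrict_space borel {0..1::real}). x = \<pi>} = {0..1} \<inter> {\<pi>}"
      by (auto simp: space_restrict_space)
    then have "Measurable.pred (restrict_space borel {0..1}) (\<lambda>x::real. x = \<pi>)"
      unfolding pred_def by (auto simp: sets_restrict_space)
    then show ?thesis
      using \<mu> unfolding policy_def fun_upd_def by (intro measurable_If) (auto simp: pred_def)
  qed
  then have better: "J \<mu> x \<le> J ?\<mu>' x" if "x \<in> {0..1}" for x
    using opt that unfolding optimal_policy_def by blast
  obtain M where M: "\<And>x \<mu>. x \<in> {0..1} \<Longrightarrow> \<bar>J \<mu> x\<bar> \<le> M" using J_bounded by blast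
  have le: "J ?\<mu>' x \<le> J \<mu> x" if "x \<in> {0..1}" for x
  proof -
    have "J ?\<mu>' x - J \<mu> x \<le> 0"
    proof (rule discounted_subsolution_nonpos[OF _ _ that])
      fix x :: real assume x: "x \<in> {0..1}"
      show "J ?\<mu>' x - J \<mu> x \<le> 2 * M" using M[OF x, of \<mu>] M[OF x, of ?\<mu>'] by linarith
      \<comment> \<open>The one-step lookahead of the modified policy never exceeds
        \<open>J \<mu>\<close>: equality holds away from \<pi>, and \<open>neg\<close> applies at
        \<pi>. So the difference of the two costs is a discounted subsolution.\<close>
      have "cost x (?\<mu>' x) + \<gamma> * future (?\<mu>' x) (J \<mu>) x \<le> J \<mu> x"
        using neg J_bellman[OF x, of \<mu>] by (cases "x = \<pi>") auto
      then show "J ?\<mu>' x - J \<mu> x \<le> \<gamma> * future (?\<mu>' x) (\<lambda>x. J ?\<mu>' x - J \<mu> x) x"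
        using J_bellman[OF x, of ?\<mu>'] unfolding future_diff right_diff_distrib by linarith
    qed
    then show ?thesis by simp
  qed
  \<comment> \<open>The comparison so far is weak; the strict gap in \<open>neg\<close> is recovered
    at \<pi> by expanding the modified cost once.\<close>
  have "\<gamma> * future s (J ?\<mu>') \<pi> \<le> \<gamma> * future s (J \<mu>) \<pi>"
    using future_mono[OF \<pi> le] gamma by simp
  then have "J ?\<mu>' \<pi> < J \<mu> \<pi>"
    using neg J_bellman[OF \<pi>, of ?\<mu>'] by simp
  with better[OF \<pi>] show False by simp
qed

primrec value_iter :: "nat \<Rightarrow> real \<Rightarrow> real" where
  "value_iter 0 = (\<lambda>_. 0)"
| "value_iter (Suc n) = (\<lambda>\<pi>. min (cost \<pi> Cheap + \<gamma> * future Cheap (value_iter n) \<pi>)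
                                (cost \<pi> Expensive + \<gamma> * future Expensive (value_iter n) \<pi>))"

text \<open>The operator \<open>future\<close>, scaling by \<gamma>, adding a concave stage cost and
  taking minima all preserve concavity.\<close>

lemma concave_value_iter:
  assumes "\<And>s. concave_on {0..1} (\<lambda>\<pi>. cost \<pi> s)"
  shows "concave_on {0..1} (value_iter n)"
proof (induction n)
  case 0
  then show ?case by (simp add: concave_on_iff)
next
  case (Suc n)
  have "concave_on {0..1} (\<lambda>\<pi>. cost \<pi> s + \<gamma> * future s (value_iter n) \<pi>)" for s
    using assms[of s] concave_on_future[OF Suc, of s] gamma
    by (intro concave_on_add concave_on_cmul) auto
  then show ?case by (simp add: concave_on_min)
qed

text \<open>No deviation helps, so \<open>J \<mu>\<close> lies below both lookaheads; by its own
  Bellman equation it equals one of them.\<close>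

lemma optimal_bellman:
  assumes opt: "optimal_policy (\<lambda>_. A) A \<alpha> \<tau> \<gamma> lam \<mu>" and \<pi>: "\<pi> \<in> {0..1}"
  shows "J \<mu> \<pi> = min (cost \<pi> Cheap + \<gamma> * future Cheap (J \<mu>) \<pi>)
                      (cost \<pi> Expensive + \<gamma> * future Expensive (J \<mu>) \<pi>)"
  using optimal_le_deviation[OF opt \<pi>, of Cheap] optimal_le_deviation[OF opt \<pi>, of Expensive]
    J_bellman[OF \<pi>, of \<mu>]
  by (cases "\<mu> \<pi>") auto

text \<open>Neither \<open>future\<close> nor the minimum enlarges a uniform error bound, so each
  iteration shrinks it by the factor \<gamma>.\<close>

lemma value_iter_tendsto:
  assumes opt: "optimal_policy (\<lambda>_. A) A \<alpha> \<tau> \<gamma> lam \<mu>" and \<pi>: "\<pi> \<in> {0..1}"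
  shows "(\<lambda>n. value_iter n \<pi>) \<longlonglongrightarrow> J \<mu> \<pi>"
proof -
  obtain M where M: "\<And>x. x \<in> {0..1} \<Longrightarrow> \<bar>J \<mu> x\<bar> \<le> M" using J_bounded by blast
  have err: "\<bar>value_iter n x - J \<mu> x\<bar> \<le> \<gamma> ^ n * M" if "x \<in> {0..1}" for n x
    using that
  proof (induction n arbitrary: x)
    case (Suc n)
    have d: "\<bar>\<gamma> * future s (value_iter n) x - \<gamma> * future s (J \<mu>) x\<bar> \<le> \<gamma> ^ Suc n * M" for s
    proof -
      have "- (\<gamma> ^ n * M) \<le> value_iter n y - J \<mu> y \<and> value_iter n y - J \<mu> y \<le> \<gamma> ^ n * M"
        if "y \<in> {0..1}" for y
        using Suc.IH[OF that] by (auto simp: abs_le_iff)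
      from future_bounds[OF Suc.prems, where v = "\<lambda>y. value_iter n y - J \<mu> y" and s = s, OF this]
      have "\<bar>future s (value_iter n) x - future s (J \<mu>) x\<bar> \<le> \<gamma> ^ n * M"
        by (simp add: future_diff abs_le_iff)
      from mult_left_mono[OF this, of \<gamma>] gamma
      have "\<bar>\<gamma> * (future s (value_iter n) x - future s (J \<mu>) x)\<bar> \<le> \<gamma> ^ Suc n * M"
        by (simp add: abs_mult mult.assoc)
      then show ?thesis by (simp add: right_diff_distrib)
    qed
    have min_diff: "\<bar>min a b - min c d\<bar> \<le> e" if "\<bar>a - c\<bar> \<le> e" "\<bar>b - d\<bar> \<le> e" for a b c d e :: real
      using that by linarith
    show ?case
      unfolding value_iter.simps by (subst optimal_bellman[OF opt Suc.prems], rule min_diff) (use d in simp_all)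
  qed (use M in simp)
  have "(\<lambda>n. \<gamma> ^ n * M) \<longlonglongrightarrow> 0"
    using gamma by (intro tendsto_mult_left_zero LIMSEQ_power_zero) simp
  then have "(\<lambda>n. value_iter n \<pi> - J \<mu> \<pi>) \<longlonglongrightarrow> 0"
    by (rule Lim_null_comparison[rotated]) (use err[OF \<pi>] in simp)
  then show ?thesis by (simp add: LIM_zero_iff)
qed

text \<open>Concavity passes from the iterates to their pointwise limit.\<close>

lemma concave_optimal_cost:
  assumes opt: "optimal_policy (\<lambda>_. A) A \<alpha> \<tau> \<gamma> lam \<mu>"
    and C: "\<And>s. concave_on {0..1} (\<lambda>\<pi>. cost \<pi> s)"
  shows "concave_on {0..1} (J \<mu>)"
  unfolding concave_on_iff
proof (intro conjI ballI allI impI)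
  fix x y r t :: real
  assume x: "x \<in> {0..1}" and y: "y \<in> {0..1}" and rt: "0 \<le> r" "0 \<le> t" "r + t = 1"
  have z: "r *\<^sub>R x + t *\<^sub>R y \<in> {0..1}"
    using convexD[of "{0..1::real}" x y r t] x y rt by simp
  show "r * J \<mu> x + t * J \<mu> y \<le> J \<mu> (r *\<^sub>R x + t *\<^sub>R y)"
  proof (rule LIMSEQ_le)
    show "(\<lambda>n. r * value_iter n x + t * value_iter n y) \<longlonglongrightarrow> r * J \<mu> x + t * J \<mu> y"
      by (intro tendsto_intros value_iter_tendsto[OF opt] x y)
    show "(\<lambda>n. value_iter n (r *\<^sub>R x + t *\<^sub>R y)) \<longlonglongrightarrow> J \<mu> (r *\<^sub>R x + t *\<^sub>R y)"
      by (rule value_iter_tendsto[OF opt z])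
    show "\<exists>N. \<forall>n\<ge>N. r * value_iter n x + t * value_iter n y \<le> value_iter n (r *\<^sub>R x + t *\<^sub>R y)"
      using concave_value_iter[OF C] x y rt unfolding concave_on_iff by blast
  qed
qed simp

end

theorem mainTheorem2:
  fixes P :: "sensor \<Rightarrow> bool \<Rightarrow> bool pmf"
    and A :: "bool \<Rightarrow> bool pmf"
    and \<alpha> \<tau> :: "sensor \<Rightarrow> real"
    and \<gamma> lam :: real
    and \<mu> :: "real \<Rightarrow> sensor"
  assumes a00: "0 < pmf (A False) False" "pmf (A False) False < 1"
    and a11: "0 < pmf (A True) True" "pmf (A True) True < 1"
    and alpha: "\<And>s. \<alpha> s \<in> {0..1}"
    and tau: "\<And>s. \<tau> s \<in> {0..1}"
    and gamma: "0 < \<gamma>" "\<gamma> < 1"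
    and lam: "0 < lam"
    and concave: "\<And>s. concave_on {0..1} (\<lambda>\<pi>. instant_cost \<alpha> \<tau> lam \<pi> s)"
    and blackwell: "blackwell_dominates \<alpha> \<tau> Expensive Cheap"
    and action_independent: "\<And>s i j. pmf (P s i) j = pmf (A i) j"
    and optimal: "optimal_policy P A \<alpha> \<tau> \<gamma> lam \<mu>"
  shows "\<forall>\<pi>\<in>expensive_region \<alpha> \<tau> lam. \<mu> \<pi> = Expensive"
proof (rule ballI, rule ccontr)
  interpret discounted_model A \<alpha> \<tau> \<gamma> lam
    by unfold_locales (rule alpha tau gamma lam)+
  \<comment> \<open>Action independence identifies the true dynamics under either sensor with the
    kernel used by the filter.\<close>
  have "P = (\<lambda>_. A)"
    by (intro ext pmf_eqI action_independent)
  with optimal have opt: "optimal_policy (\<lambda>_. A) A \<alpha> \<tau> \<gamma> lam \<mu>" by simp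
  fix \<pi> assume "\<pi> \<in> expensive_region \<alpha> \<tau> lam" and "\<mu> \<pi> \<noteq> Expensive"
  then have \<pi>: "\<pi> \<in> {0..1}" and less: "cost \<pi> Expensive < cost \<pi> Cheap" and cheap: "\<mu> \<pi> = Cheap"
    by (auto simp: expensive_region_def) (metis sensor.exhaust)
  have "\<gamma> * future Expensive (J \<mu>) \<pi> \<le> \<gamma> * future Cheap (J \<mu>) \<pi>"
    using blackwell_future_le[OF concave_optimal_cost[OF opt concave] blackwell \<pi>] gamma by simp
  \<comment> \<open>As \<mu> chooses \<open>Cheap\<close> at \<pi>, \<open>J \<mu> \<pi>\<close> is
    the \<open>Cheap\<close> lookahead, which exceeds the \<open>Expensive\<close> one by the strict
    gap in stage cost.\<close>
  with less have "cost \<pi> Expensive + \<gamma> * future Expensive (J \<mu>) \<pi> < J \<mu> \<pi>"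
    using J_bellman[OF \<pi>, of \<mu>] cheap by simp
  with optimal_le_deviation[OF opt \<pi>, of Expensive] show False by simp
qed

end
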